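(* The subgroup of $\widetilde B_\bullet$ generated by $\{\sigma_i: i\ge1\}$ is (a copy of) Artin's braid group $B_\infty$, and the subgroup of $\widetilde B_\bullet$ generated by $\{a_i:i\ge1\}$ is (a copy of) Thompson's group $F$ (in both cases through the identity mapping on the generators). These two subgroups generate $\widetilde B_\bullet$, and their intersection is $\{1\}$.
   Context: $\widetilde B_\bullet$ is the group presented by generators $\sigma_i,a_i$ ($i\ge1$) and the relations, for all $i\ge1$ and $j\ge i+2$: $\sigma_i\sigma_j=\sigma_j\sigma_i$, $\sigma_ia_j=a_j\sigma_i$, $a_ia_{j-1}=a_ja_i$, $a_i\sigma_{j-1}=\sigma_ja_i$, $\sigma_i\sigma_{i+1}\sigma_i=\sigma_{i+1}\sigma_i\sigma_{i+1}$, $\sigma_{i+1}\sigma_ia_{i+1}=a_i\sigma_i$, $\sigma_i\sigma_{i+1}a_i=a_{i+1}\sigma_i$. Artin's group $B_\infty$ is the group presented by generators $\sigma_i$ ($i\ge1$) and relations $\sigma_i\sigma_j=\sigma_j\sigma_i$ ($j\ge i+2$), $\sigma_i\sigma_{i+1}\sigma_i=\sigma_{i+1}\sigma_i\sigma_{i+1}$. Thompson's group $F$ is the group presented by generators $a_i$ ($i\ge1$) and relations $a_ia_{j-1}=a_ja_i$ for $j\ge i+2$ (so $a_i=x_{i-1}^{-1}$ in terms of the standard generators $x_0,x_1,\dots$ of $F$). *)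

theory Defs
  imports "HOL-Algebra.Generated_Groups"
begin

section \<open>Groups given by generators and relations\<close>

text \<open>A word over the generators \<open>X\<close> is a list of letters, where \<open>(x, True)\<close> stands for \<open>x\<close>
  and \<open>(x, False)\<close> for its formal inverse.\<close>

type_synonym 'g word = "('g \<times> bool) list"

abbreviation words :: "'g set \<Rightarrow> 'g word set" where
  "words X \<equiv> lists (X \<times> UNIV)"

text \<open>The congruence on words generated by free cancellation and by the relations \<open>u = v\<close> with
  \<open>(u, v) \<in> R\<close>. Relations that mention letters outside \<open>X\<close> are ignored.\<close>

inductive_set pres_rel :: "'g set \<Rightarrow> ('g word \<times> 'g word) set \<Rightarrow> ('g word \<times> 'g word) set"
  for X :: "'g set" and R :: "('g word \<times> 'g word) set" where
  refl: "w \<in> words X \<Longrightarrow> (w, w) \<in> pres_rel X R"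
| sym: "(u, v) \<in> pres_rel X R \<Longrightarrow> (v, u) \<in> pres_rel X R"
| trans: "(u, v) \<in> pres_rel X R \<Longrightarrow> (v, w) \<in> pres_rel X R \<Longrightarrow> (u, w) \<in> pres_rel X R"
| ctxt: "(u, v) \<in> pres_rel X R \<Longrightarrow> p \<in> words X \<Longrightarrow> q \<in> words X
    \<Longrightarrow> (p @ u @ q, p @ v @ q) \<in> pres_rel X R"
| cancel: "x \<in> X \<Longrightarrow> ([(x, b), (x, \<not> b)], []) \<in> pres_rel X R"
| rel: "(u, v) \<in> R \<Longrightarrow> u \<in> words X \<Longrightarrow> v \<in> words X \<Longrightarrow> (u, v) \<in> pres_rel X R"

definition presented_group :: "'g set \<Rightarrow> ('g word \<times> 'g word) set \<Rightarrow> 'g word set monoid" where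
  "presented_group X R =
    \<lparr>carrier = words X // pres_rel X R,
     mult = (\<lambda>A B. \<Union>u\<in>A. \<Union>v\<in>B. pres_rel X R `` {u @ v}),
     one = pres_rel X R `` {[]}\<rparr>"

definition pres_gen :: "'g set \<Rightarrow> ('g word \<times> 'g word) set \<Rightarrow> 'g \<Rightarrow> 'g word set" where
  "pres_gen X R x = pres_rel X R `` {[(x, True)]}"

lemma pres_rel_words: "(u, v) \<in> pres_rel X R \<Longrightarrow> u \<in> words X \<and> v \<in> words X"
  by (induction rule: pres_rel.induct) auto

lemma equiv_pres_rel: "equiv (words X) (pres_rel X R)"
proof (rule equivI)
  show "pres_rel X R \<subseteq> words X \<times> words X"
    by (auto simp del: in_lists_conv_set dest: pres_rel_words)
  show "refl_on (words X) (pres_rel X R)"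
    by (rule refl_onI) (rule pres_rel.refl)
  show "sym (pres_rel X R)"
    by (rule symI) (rule pres_rel.sym)
  show "trans (pres_rel X R)"
    by (rule transI) (rule pres_rel.trans)
qed

lemma pres_rel_append:
  assumes "(u, u') \<in> pres_rel X R" "(v, v') \<in> pres_rel X R"
  shows "(u @ v, u' @ v') \<in> pres_rel X R"
proof -
  have "([] @ u @ v, [] @ u' @ v) \<in> pres_rel X R"
    using assms pres_rel_words[OF assms(2)] by (intro pres_rel.ctxt) auto
  moreover have "(u' @ v @ [], u' @ v' @ []) \<in> pres_rel X R"
    using assms pres_rel_words[OF assms(1)] by (intro pres_rel.ctxt) auto
  ultimately show ?thesis
    using pres_rel.trans[of "u @ v" "u' @ v" X R "u' @ v'"] by simp
qed

lemma presented_group_mult: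
  assumes "u \<in> words X" "v \<in> words X"
  shows "(pres_rel X R `` {u}) \<otimes>\<^bsub>presented_group X R\<^esub> (pres_rel X R `` {v})
    = pres_rel X R `` {u @ v}"
proof -
  have "pres_rel X R `` {u' @ v'} = pres_rel X R `` {u @ v}"
    if "(u, u') \<in> pres_rel X R" "(v, v') \<in> pres_rel X R" for u' v'
    using equiv_class_eq[OF equiv_pres_rel pres_rel_append[OF that]] by simp
  then have "(\<Union>u'\<in>pres_rel X R `` {u}. \<Union>v'\<in>pres_rel X R `` {v}. pres_rel X R `` {u' @ v'})
      = (\<Union>u'\<in>pres_rel X R `` {u}. \<Union>v'\<in>pres_rel X R `` {v}. pres_rel X R `` {u @ v})"
    by (intro SUP_cong HOL.refl) blast
  also have "\<dots> = pres_rel X R `` {u @ v}"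
    using pres_rel.refl[OF assms(1), of R] pres_rel.refl[OF assms(2), of R] by blast
  finally show ?thesis
    by (simp add: presented_group_def)
qed

lemma carrier_presented_group: "carrier (presented_group X R) = words X // pres_rel X R"
  by (simp add: presented_group_def)

lemma one_presented_group: "\<one>\<^bsub>presented_group X R\<^esub> = pres_rel X R `` {[]}"
  by (simp add: presented_group_def)

lemma class_in_carrier: "u \<in> words X \<Longrightarrow> pres_rel X R `` {u} \<in> carrier (presented_group X R)"
  by (simp add: carrier_presented_group quotientI)

lemma in_carrierE:
  assumes "A \<in> carrier (presented_group X R)"
  obtains u where "u \<in> words X" "A = pres_rel X R `` {u}"
  using assms that by (auto simp: carrier_presented_group simp del: in_lists_conv_set elim!: quotientE)

definition word_inv :: "'g word \<Rightarrow> 'g word" where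
  "word_inv w = rev (map (\<lambda>(x, b). (x, \<not> b)) w)"

lemma word_inv_words: "w \<in> words X \<Longrightarrow> word_inv w \<in> words X"
  by (auto simp: word_inv_def)

lemma word_inv_cancel: "w \<in> words X \<Longrightarrow> (word_inv w @ w, []) \<in> pres_rel X R"
proof (induction w)
  case Nil
  then show ?case by (simp add: word_inv_def pres_rel.refl)
next
  case (Cons l w)
  obtain x b where l: "l = (x, b)" by fastforce
  have w: "w \<in> words X" and x: "x \<in> X"
    using Cons.prems l by auto
  have "(word_inv w @ [(x, \<not> b), (x, \<not> \<not> b)] @ w, word_inv w @ [] @ w) \<in> pres_rel X R"
    by (intro pres_rel.ctxt pres_rel.cancel x word_inv_words w)
  then have "(word_inv (l # w) @ l # w, word_inv w @ w) \<in> pres_rel X R"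
    by (simp add: word_inv_def l)
  then show ?case
    using Cons.IH[OF w] by (rule pres_rel.trans)
qed

theorem group_presented_group: "group (presented_group X R)"
proof (rule groupI)
  fix A B C
  assume "A \<in> carrier (presented_group X R)" "B \<in> carrier (presented_group X R)"
    "C \<in> carrier (presented_group X R)"
  then obtain u v w where uvw: "u \<in> words X" "v \<in> words X" "w \<in> words X"
    and ABC: "A = pres_rel X R `` {u}" "B = pres_rel X R `` {v}" "C = pres_rel X R `` {w}"
    by (elim in_carrierE)
  have "u @ v \<in> words X" "v @ w \<in> words X"
    using uvw by auto
  with uvw ABC show "A \<otimes>\<^bsub>presented_group X R\<^esub> B \<otimes>\<^bsub>presented_group X R\<^esub> C
      = A \<otimes>\<^bsub>presented_group X R\<^esub> (B \<otimes>\<^bsub>presented_group X R\<^esub> C)"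
    by (simp add: presented_group_mult del: in_lists_conv_set append_in_lists_conv)
next
  fix A B
  assume "A \<in> carrier (presented_group X R)" "B \<in> carrier (presented_group X R)"
  then show "A \<otimes>\<^bsub>presented_group X R\<^esub> B \<in> carrier (presented_group X R)"
    by (elim in_carrierE)
      (simp add: presented_group_mult class_in_carrier del: in_lists_conv_set)
next
  fix A
  assume "A \<in> carrier (presented_group X R)"
  then obtain u where u: "u \<in> words X" "A = pres_rel X R `` {u}"
    by (rule in_carrierE)
  show "\<one>\<^bsub>presented_group X R\<^esub> \<otimes>\<^bsub>presented_group X R\<^esub> A = A"
    using u by (simp add: one_presented_group presented_group_mult del: in_lists_conv_set)
  have "pres_rel X R `` {word_inv u} \<otimes>\<^bsub>presented_group X R\<^esub> A = \<one>\<^bsub>presented_group X R\<^esub>"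
    using equiv_class_eq[OF equiv_pres_rel word_inv_cancel[OF u(1)]]
    by (simp only: u(2) presented_group_mult[OF word_inv_words[OF u(1)] u(1)] one_presented_group)
  then show "\<exists>B\<in>carrier (presented_group X R).
      B \<otimes>\<^bsub>presented_group X R\<^esub> A = \<one>\<^bsub>presented_group X R\<^esub>"
    using class_in_carrier[OF word_inv_words[OF u(1)]] by blast
qed (auto simp: one_presented_group intro: class_in_carrier)

text \<open>The universal property of a presentation; the homomorphism is unique on the carrier because
  \<open>pres_gen X R ` X\<close> generates (\<open>generate_pres_gen\<close>).\<close>

definition word_eval :: "('h, 'b) monoid_scheme \<Rightarrow> ('g \<Rightarrow> 'h) \<Rightarrow> 'g word \<Rightarrow> 'h" where
  "word_eval H f w =
    foldr (\<lambda>(x, b) y. (if b then f x else inv\<^bsub>H\<^esub> f x) \<otimes>\<^bsub>H\<^esub> y) w \<one>\<^bsub>H\<^esub>"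

lemma word_eval_closed:
  assumes "group H" "f ` X \<subseteq> carrier H" "w \<in> words X"
  shows "word_eval H f w \<in> carrier H"
proof -
  interpret group H by fact
  from assms(3,2) show ?thesis
    by (induction w) (auto simp: word_eval_def)
qed

lemma word_eval_append:
  assumes "group H" "f ` X \<subseteq> carrier H" "u \<in> words X" "v \<in> words X"
  shows "word_eval H f (u @ v) = word_eval H f u \<otimes>\<^bsub>H\<^esub> word_eval H f v"
proof -
  interpret group H by fact
  show ?thesis
    using assms(3)
  proof (induction u rule: list.induct)
    case Nil
    then show ?case
      using word_eval_closed[OF assms(1,2,4)] by (simp add: word_eval_def)
  next
    case (Cons l u)
    obtain x b where l: "l = (x, b)" by fastforce
    have u: "u \<in> words X" and x: "f x \<in> carrier H"
      using Cons.prems l assms(2) by auto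
    have "word_eval H f (l # w) = (if b then f x else inv\<^bsub>H\<^esub> f x) \<otimes>\<^bsub>H\<^esub> word_eval H f w" for w
      by (simp add: word_eval_def l)
    then show ?case
      using Cons.IH[OF u] x word_eval_closed[OF assms(1,2) u] word_eval_closed[OF assms(1,2,4)]
      by (simp add: m_assoc)
  qed
qed

lemma word_eval_pres_rel:
  assumes H: "group H" and f: "f ` X \<subseteq> carrier H"
    and R: "\<And>u v. (u, v) \<in> R \<Longrightarrow> u \<in> words X \<Longrightarrow> v \<in> words X
      \<Longrightarrow> word_eval H f u = word_eval H f v"
    and "(u, v) \<in> pres_rel X R"
  shows "word_eval H f u = word_eval H f v"
  using assms(4)
proof (induction rule: pres_rel.induct)
  case (ctxt u v p q)
  have "u \<in> words X" "v \<in> words X"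
    using pres_rel_words[OF ctxt.hyps(1)] by auto
  then have uq: "u @ q \<in> words X" "v @ q \<in> words X"
    using ctxt.hyps by auto
  show ?case
    using ctxt \<open>u \<in> words X\<close> \<open>v \<in> words X\<close> uq by (simp only: word_eval_append[OF H f])
next
  case (cancel x b)
  interpret group H by fact
  have "f x \<in> carrier H" using cancel f by auto
  then show ?case by (cases b) (simp_all add: word_eval_def)
qed (use R in auto)

theorem presented_group_universal:
  assumes H: "group H" and f: "f ` X \<subseteq> carrier H"
    and R: "\<And>u v. (u, v) \<in> R \<Longrightarrow> u \<in> words X \<Longrightarrow> v \<in> words X
      \<Longrightarrow> word_eval H f u = word_eval H f v"
  shows "\<exists>h \<in> hom (presented_group X R) H. \<forall>x\<in>X. h (pres_gen X R x) = f x"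
proof -
  interpret group H by fact
  define h where "h A = word_eval H f (SOME u. u \<in> A)" for A
  have h: "h (pres_rel X R `` {u}) = word_eval H f u" if "u \<in> words X" for u
  proof -
    have "u \<in> pres_rel X R `` {u}"
      using pres_rel.refl[OF that] by simp
    then have "(SOME v. v \<in> pres_rel X R `` {u}) \<in> pres_rel X R `` {u}"
      by (rule someI)
    then have "(u, SOME v. v \<in> pres_rel X R `` {u}) \<in> pres_rel X R"
      by simp
    from word_eval_pres_rel[OF H f R this] show ?thesis
      by (simp only: h_def)
  qed
  have "h \<in> hom (presented_group X R) H"
  proof (rule homI)
    fix A assume "A \<in> carrier (presented_group X R)"
    then show "h A \<in> carrier H"
      by (elim in_carrierE) (simp only: h word_eval_closed[OF H f])
  next
    fix A B
    assume "A \<in> carrier (presented_group X R)" "B \<in> carrier (presented_group X R)"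
    then obtain u v where u: "u \<in> words X" "A = pres_rel X R `` {u}"
      and v: "v \<in> words X" "B = pres_rel X R `` {v}"
      by (elim in_carrierE)
    have "u @ v \<in> words X"
      using u v by auto
    then show "h (A \<otimes>\<^bsub>presented_group X R\<^esub> B) = h A \<otimes>\<^bsub>H\<^esub> h B"
      by (simp only: u(2) v(2) presented_group_mult[OF u(1) v(1)] h u(1) v(1)
          word_eval_append[OF H f u(1) v(1)])
  qed
  moreover have "h (pres_gen X R x) = f x" if "x \<in> X" for x
    using that f h[of "[(x, True)]"] by (auto simp: pres_gen_def word_eval_def)
  ultimately show ?thesis by blast
qed

theorem generate_pres_gen:
  "generate (presented_group X R) (pres_gen X R ` X) = carrier (presented_group X R)"
proof -
  interpret G: group "presented_group X R" by (rule group_presented_group)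
  have gen: "pres_gen X R ` X \<subseteq> carrier (presented_group X R)"
    by (auto simp: pres_gen_def intro!: class_in_carrier)
  have letter: "pres_rel X R `` {[(x, b)]} \<in> generate (presented_group X R) (pres_gen X R ` X)"
    if x: "x \<in> X" for x b
  proof (cases b)
    case True
    then show ?thesis using x by (auto simp: pres_gen_def[symmetric] intro: generate.incl)
  next
    case False
    have "pres_rel X R `` {[(x, False)]} \<otimes>\<^bsub>presented_group X R\<^esub> pres_gen X R x
        = \<one>\<^bsub>presented_group X R\<^esub>"
      using presented_group_mult[of "[(x, False)]" X "[(x, True)]" R] x
        equiv_class_eq[OF equiv_pres_rel pres_rel.cancel[OF x, of False]]
      by (simp add: pres_gen_def one_presented_group)
    then have "inv\<^bsub>presented_group X R\<^esub> pres_gen X R x = pres_rel X R `` {[(x, False)]}"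
      using x gen by (intro G.inv_equality) (auto intro!: class_in_carrier)
    then show ?thesis
      using False x generate.inv[of "pres_gen X R x" "pres_gen X R ` X" "presented_group X R"] by auto
  qed
  have word: "pres_rel X R `` {w} \<in> generate (presented_group X R) (pres_gen X R ` X)"
    if "w \<in> words X" for w
    using that
  proof (induction w rule: list.induct)
    case Nil
    then show ?case
      using generate.one[of "presented_group X R" "pres_gen X R ` X"]
      by (simp add: one_presented_group)
  next
    case (Cons l w)
    obtain x b where l: "l = (x, b)" by fastforce
    have w: "w \<in> words X" and x: "x \<in> X" using Cons.prems l by auto
    then show ?case
      using generate.eng[OF letter[OF x, of b] Cons.IH[OF w]]
        presented_group_mult[of "[(x, b)]" X w R] by (simp add: l)
  qed
  show ?thesis
  proof
    show "generate (presented_group X R) (pres_gen X R ` X) \<subseteq> carrier (presented_group X R)"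
      by (rule G.generate_incl[OF gen])
    show "carrier (presented_group X R) \<subseteq> generate (presented_group X R) (pres_gen X R ` X)"
    proof
      fix A assume "A \<in> carrier (presented_group X R)"
      then obtain w where "w \<in> words X" "A = pres_rel X R `` {w}"
        by (rule in_carrierE)
      then show "A \<in> generate (presented_group X R) (pres_gen X R ` X)"
        using word by (simp only:)
    qed
  qed
qed


section \<open>The three groups\<close>

text \<open>All three groups use the same alphabet, so that the identity on letters makes sense. Indices
  start at 1; the letters \<open>Sig 0\<close> and \<open>Aa 0\<close> are not generators of any of them.\<close>

datatype letter = Sig nat | Aa nat

abbreviation sg :: "nat \<Rightarrow> letter \<times> bool" where "sg i \<equiv> (Sig i, True)"
abbreviation al :: "nat \<Rightarrow> letter \<times> bool" where "al i \<equiv> (Aa i, True)"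

definition sigma_letters :: "letter set" where
  "sigma_letters = {Sig i |i. 1 \<le> i}"

definition a_letters :: "letter set" where
  "a_letters = {Aa i |i. 1 \<le> i}"

definition artin_rels :: "(letter word \<times> letter word) set" where
  "artin_rels =
     {([sg i, sg j], [sg j, sg i]) |i j. 1 \<le> i \<and> i + 2 \<le> j}
   \<union> {([sg i, sg (i + 1), sg i], [sg (i + 1), sg i, sg (i + 1)]) |i. 1 \<le> i}"

definition thompson_rels :: "(letter word \<times> letter word) set" where
  "thompson_rels = {([al i, al (j - 1)], [al j, al i]) |i j. 1 \<le> i \<and> i + 2 \<le> j}"

definition mixed_rels :: "(letter word \<times> letter word) set" where
  "mixed_rels =
     {([sg i, al j], [al j, sg i]) |i j. 1 \<le> i \<and> i + 2 \<le> j}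
   \<union> {([al i, sg (j - 1)], [sg j, al i]) |i j. 1 \<le> i \<and> i + 2 \<le> j}
   \<union> {([sg (i + 1), sg i, al (i + 1)], [al i, sg i]) |i. 1 \<le> i}
   \<union> {([sg i, sg (i + 1), al i], [al (i + 1), sg i]) |i. 1 \<le> i}"

definition B_infinity :: "letter word set monoid" where
  "B_infinity = presented_group sigma_letters artin_rels"

definition B_infinity_gen :: "nat \<Rightarrow> letter word set" where
  "B_infinity_gen i = pres_gen sigma_letters artin_rels (Sig i)"

definition thompson_F :: "letter word set monoid" where
  "thompson_F = presented_group a_letters thompson_rels"

definition thompson_F_gen :: "nat \<Rightarrow> letter word set" where
  "thompson_F_gen i = pres_gen a_letters thompson_rels (Aa i)"

definition B_tilde :: "letter word set monoid" where
  "B_tilde = presented_group (sigma_letters \<union> a_letters) (artin_rels \<union> thompson_rels \<union> mixed_rels)"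

definition B_tilde_sigma :: "nat \<Rightarrow> letter word set" where
  "B_tilde_sigma i =
    pres_gen (sigma_letters \<union> a_letters) (artin_rels \<union> thompson_rels \<union> mixed_rels) (Sig i)"

definition B_tilde_a :: "nat \<Rightarrow> letter word set" where
  "B_tilde_a i =
    pres_gen (sigma_letters \<union> a_letters) (artin_rels \<union> thompson_rels \<union> mixed_rels) (Aa i)"

end

theory Submission
  imports Defs Complex_Main
begin

declare One_nat_def [simp del]

text \<open>The group acts on the real line: \<open>a\<^sub>i\<close> stretches \<open>[i - 1, i]\<close> by the factor 2 and pushes the
  points to the right of it, and \<open>\<sigma>\<^sub>i\<close> exchanges the intervals \<open>[i - 1, i)\<close> and \<open>[i, i + 1)\<close>.
  On \<open>F\<close> this action is faithful, because an element of \<open>F\<close> is a fraction of two weakly decreasing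
  positive words, and the last letter of such a word can be read off from its action. An element of
  the intersection acts monotonically and by permuting unit intervals, hence trivially.

  For \<open>B\<^sub>\<infinity>\<close>, put strands at a locally finite set \<open>P\<close> of points. Moving \<open>P\<close> along the action, each
  \<open>\<sigma>\<^sub>i\<close> makes the strands in \<open>[i - 1, i)\<close> cross those in \<open>[i, i + 1)\<close>, while \<open>a\<^sub>i\<close> produces no
  crossing. The defining relations become identities between block crossings in \<open>B\<^sub>\<infinity>\<close>, so this is
  a cocycle with values in \<open>B\<^sub>\<infinity>\<close>. If \<open>P\<close> has exactly one point in each unit interval, the cocycle
  maps every braid word to its own class.\<close>

section \<open>Subgroups generated by part of the generators\<close>

lemma word_inv_word_inv [simp]: "word_inv (word_inv w) = w"
  by (auto simp: word_inv_def rev_map intro!: map_idI)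

lemma pres_rel_append_word_inv: "w \<in> words X \<Longrightarrow> (w @ word_inv w, []) \<in> pres_rel X R"
  using word_inv_cancel[OF word_inv_words, of w X R] by simp

lemma pres_rel_if_word_inv_append:
  assumes "u \<in> words X" "v \<in> words X" "(word_inv v @ u, []) \<in> pres_rel X R"
  shows "(u, v) \<in> pres_rel X R"
proof -
  have "((v @ word_inv v) @ u, [] @ u) \<in> pres_rel X R"
    by (intro pres_rel_append pres_rel_append_word_inv pres_rel.refl assms)
  moreover have "(v @ (word_inv v @ u), v @ []) \<in> pres_rel X R"
    by (intro pres_rel_append pres_rel.refl assms)
  ultimately show ?thesis
    by (auto intro: pres_rel.sym pres_rel.trans)
qed

lemma pres_rel_mono:
  assumes "X \<subseteq> Y" "R \<subseteq> R'"
  shows "pres_rel X R \<subseteq> pres_rel Y R'"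
proof -
  have words: "words X \<subseteq> words Y"
    using assms(1) by (intro lists_mono Sigma_mono) auto
  have "(u, v) \<in> pres_rel Y R'" if "(u, v) \<in> pres_rel X R" for u v
    using that
  proof (induction rule: pres_rel.induct)
    case (sym u v)
    then show ?case by (blast intro: pres_rel.sym)
  next
    case (trans u v w)
    then show ?case by (blast intro: pres_rel.trans)
  qed (use words assms in \<open>blast intro: pres_rel.intros\<close>)+
  then show ?thesis by auto
qed

lemma pres_rel_class_eq_iff:
  assumes "u \<in> words X" "v \<in> words X"
  shows "pres_rel X R `` {u} = pres_rel X R `` {v} \<longleftrightarrow> (u, v) \<in> pres_rel X R"
  using eq_equiv_class_iff[OF equiv_pres_rel assms] .

lemma inv_pres_rel_class:
  assumes "w \<in> words X"
  shows "inv\<^bsub>presented_group X R\<^esub> (pres_rel X R `` {w}) = pres_rel X R `` {word_inv w}"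
proof -
  interpret group "presented_group X R" by (rule group_presented_group)
  have "pres_rel X R `` {word_inv w} \<otimes>\<^bsub>presented_group X R\<^esub> (pres_rel X R `` {w})
      = \<one>\<^bsub>presented_group X R\<^esub>"
    using equiv_class_eq[OF equiv_pres_rel word_inv_cancel[OF assms]]
    by (simp only: presented_group_mult[OF word_inv_words[OF assms] assms] one_presented_group)
  then show ?thesis
    by (intro inv_equality class_in_carrier word_inv_words assms)
qed

text \<open>Describes the subgroup by words over the smaller alphabet, so that embeddings and the
  intersection can be treated on representatives.\<close>

lemma generate_pres_gen_subset:
  assumes "X \<subseteq> Y"
  shows "generate (presented_group Y R) (pres_gen Y R ` X) = (\<lambda>w. pres_rel Y R `` {w}) ` words X"
    (is "generate ?G ?S = ?W")
proof
  interpret group ?G by (rule group_presented_group)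
  have words: "words X \<subseteq> words Y"
    using assms by (intro lists_mono Sigma_mono) auto
  show "generate ?G ?S \<subseteq> ?W"
  proof
    fix g assume "g \<in> generate ?G ?S"
    then show "g \<in> ?W"
    proof (induction rule: generate.induct)
      case one
      then show ?case by (auto simp: one_presented_group)
    next
      case (incl h)
      then show ?case by (auto simp: pres_gen_def)
    next
      case (inv h)
      then obtain x where x: "x \<in> X" "h = pres_gen Y R x" by auto
      then have "inv\<^bsub>?G\<^esub> h = pres_rel Y R `` {[(x, False)]}"
        using inv_pres_rel_class[of "[(x, True)]" Y R] assms
        by (auto simp: pres_gen_def word_inv_def)
      then show ?case using x by auto
    next
      case (eng g h)
      then obtain u v where uv: "u \<in> words X" "v \<in> words X"
        and "g = pres_rel Y R `` {u}" "h = pres_rel Y R `` {v}" by blast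
      then have "g \<otimes>\<^bsub>?G\<^esub> h = pres_rel Y R `` {u @ v}"
        using words by (simp add: presented_group_mult subset_iff del: in_lists_conv_set)
      moreover have "u @ v \<in> words X" using uv by auto
      ultimately show ?case by blast
    qed
  qed
  show "?W \<subseteq> generate ?G ?S"
  proof (rule image_subsetI)
    fix w assume "w \<in> words X"
    then show "pres_rel Y R `` {w} \<in> generate ?G ?S"
    proof (induction w rule: list.induct)
      case Nil
      then show ?case
        using generate.one[of ?G ?S] by (simp add: one_presented_group)
    next
      case (Cons l w)
      obtain x b where l: "l = (x, b)" by fastforce
      have x: "x \<in> X" and w: "w \<in> words X" using Cons.prems l by auto
      have letter: "[(x, b)] \<in> words Y" for b using x assms by auto
      have "pres_rel Y R `` {[(x, b)]} \<in> generate ?G ?S"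
      proof (cases b)
        case True
        then show ?thesis using x by (auto simp: pres_gen_def[symmetric] intro: generate.incl)
      next
        case False
        then have "pres_rel Y R `` {[(x, b)]} = inv\<^bsub>?G\<^esub> pres_gen Y R x"
          using inv_pres_rel_class[OF letter[of True], of R] by (simp add: pres_gen_def word_inv_def)
        then show ?thesis using x by (auto intro: generate.inv)
      qed
      from generate.eng[OF this Cons.IH[OF w]] show ?case
        using presented_group_mult[OF letter[of b] subsetD[OF words w], of R] by (simp add: l)
    qed
  qed
qed

text \<open>The canonical map exists because the larger presentation keeps all generators and
  relations of the smaller one; its injectivity is exactly the hypothesis
  \<open>conservative\<close>.\<close>

lemma presented_subgroup_iso:
  assumes "X \<subseteq> Y" "R \<subseteq> R'"
    and conservative: "\<And>u v. u \<in> words X \<Longrightarrow> v \<in> words X \<Longrightarrow> (u, v) \<in> pres_rel Y R'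
      \<Longrightarrow> (u, v) \<in> pres_rel X R"
  shows "\<exists>h \<in> iso (presented_group X R) ((presented_group Y R')
      \<lparr>carrier := generate (presented_group Y R') (pres_gen Y R' ` X)\<rparr>).
    \<forall>x\<in>X. h (pres_gen X R x) = pres_gen Y R' x"
proof -
  have words: "words X \<subseteq> words Y"
    using assms by (intro lists_mono Sigma_mono) auto
  \<comment> \<open>Saturating a class under the coarser congruence needs no choice of
    representative.\<close>
  define h where "h A = pres_rel Y R' `` A" for A
  have h: "h (pres_rel X R `` {w}) = pres_rel Y R' `` {w}" if "w \<in> words X" for w
    using that pres_rel_mono[OF assms(1,2)] pres_rel.refl[OF that, of R]
    by (auto simp: h_def intro: pres_rel.trans)
  have "h \<in> iso (presented_group X R) ((presented_group Y R')
      \<lparr>carrier := generate (presented_group Y R') (pres_gen Y R' ` X)\<rparr>)"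
    unfolding generate_pres_gen_subset[OF assms(1)]
  proof (rule isoI)
    show "h \<in> hom (presented_group X R)
        (presented_group Y R'\<lparr>carrier := (\<lambda>w. pres_rel Y R' `` {w}) ` words X\<rparr>)"
    proof (rule homI)
      fix A assume "A \<in> carrier (presented_group X R)"
      then show "h A \<in> carrier
          (presented_group Y R'\<lparr>carrier := (\<lambda>w. pres_rel Y R' `` {w}) ` words X\<rparr>)"
        by (elim in_carrierE) (simp add: h del: in_lists_conv_set)
    next
      fix A B
      assume "A \<in> carrier (presented_group X R)" "B \<in> carrier (presented_group X R)"
      then obtain u v where u: "u \<in> words X" "A = pres_rel X R `` {u}"
        and v: "v \<in> words X" "B = pres_rel X R `` {v}"
        by (elim in_carrierE)
      have "u @ v \<in> words X" "u \<in> words Y" "v \<in> words Y"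
        using u v words by auto
      then show "h (A \<otimes>\<^bsub>presented_group X R\<^esub> B) = h A
          \<otimes>\<^bsub>presented_group Y R'\<lparr>carrier := (\<lambda>w. pres_rel Y R' `` {w}) ` words X\<rparr>\<^esub> h B"
        using u v by (simp add: presented_group_mult h del: in_lists_conv_set append_in_lists_conv)
    qed
    show "bij_betw h (carrier (presented_group X R))
        (carrier (presented_group Y R'\<lparr>carrier := (\<lambda>w. pres_rel Y R' `` {w}) ` words X\<rparr>))"
    proof (rule bij_betw_imageI)
      show "inj_on h (carrier (presented_group X R))"
      proof (rule inj_onI)
        fix A B
        assume AB: "A \<in> carrier (presented_group X R)" "B \<in> carrier (presented_group X R)"
          and eq: "h A = h B"
        obtain u v where u: "u \<in> words X" "A = pres_rel X R `` {u}"
          and v: "v \<in> words X" "B = pres_rel X R `` {v}"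
          using AB by (elim in_carrierE)
        have "u \<in> words Y" "v \<in> words Y" using u v words by auto
        then have "(u, v) \<in> pres_rel Y R'"
          using eq u v pres_rel_class_eq_iff[of u Y v R'] by (simp only: h)
        then show "A = B"
          using conservative[OF u(1) v(1)] pres_rel_class_eq_iff[OF u(1) v(1), of R] u v by simp
      qed
      have "carrier (presented_group X R) = (\<lambda>w. pres_rel X R `` {w}) ` words X"
        by (auto simp: carrier_presented_group quotient_def)
      then have "h ` carrier (presented_group X R) = (\<lambda>w. h (pres_rel X R `` {w})) ` words X"
        by (simp only: image_image)
      also have "\<dots> = (\<lambda>w. pres_rel Y R' `` {w}) ` words X"
        by (rule image_cong[OF HOL.refl]) (rule h)
      finally show "h ` carrier (presented_group X R) = carrier
          (presented_group Y R'\<lparr>carrier := (\<lambda>w. pres_rel Y R' `` {w}) ` words X\<rparr>)"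
        by simp
    qed
  qed
  moreover have "h (pres_gen X R x) = pres_gen Y R' x" if "x \<in> X" for x
    using h[of "[(x, True)]"] that by (simp add: pres_gen_def)
  ultimately show ?thesis by blast
qed


section \<open>An action on the real line\<close>

definition stretch :: "nat \<Rightarrow> real \<Rightarrow> real" where
  "stretch i x = (if x \<le> real i - 1 then x else if x \<le> i then 2 * x - (real i - 1) else x + 1)"

definition shrink :: "nat \<Rightarrow> real \<Rightarrow> real" where
  "shrink i x = (if x \<le> real i - 1 then x else if x \<le> i + 1 then (x + (real i - 1)) / 2 else x - 1)"

definition exchange :: "nat \<Rightarrow> real \<Rightarrow> real" where
  "exchange i x = (if x < real i - 1 then x else if x < i then x + 1 else if x < i + 1 then x - 1 else x)"

text \<open>The sign of a \<open>Sig\<close> letter is ignored because \<open>exchange i\<close> is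
  an involution.\<close>

fun letter_act :: "letter \<times> bool \<Rightarrow> real \<Rightarrow> real" where
  "letter_act (Sig i, b) = exchange i"
| "letter_act (Aa i, b) = (if b then stretch i else shrink i)"

definition word_act :: "letter word \<Rightarrow> real \<Rightarrow> real" where
  "word_act w = foldr (\<lambda>l f. letter_act l \<circ> f) w id"

lemma word_act_simps [simp]:
  "word_act [] = id"
  "word_act (l # w) = letter_act l \<circ> word_act w"
  by (simp_all add: word_act_def)

lemma word_act_append [simp]: "word_act (u @ v) = word_act u \<circ> word_act v"
  by (induction u) (simp_all add: comp_assoc)

lemma exchange_exchange [simp]: "exchange i (exchange i x) = x"
  by (simp add: exchange_def)

lemma stretch_shrink [simp]: "stretch i (shrink i x) = x"
  by (simp add: stretch_def shrink_def field_simps)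

lemma shrink_stretch [simp]: "shrink i (stretch i x) = x"
  by (simp add: stretch_def shrink_def field_simps)

lemma letter_act_cancel [simp]: "letter_act (x, b) \<circ> letter_act (x, \<not> b) = id"
  by (cases x) (auto simp: fun_eq_iff)

lemma bij_letter_act: "bij (letter_act l)"
proof (cases l)
  case (Pair x b)
  then show ?thesis
    using o_bij[of "letter_act (x, \<not> b)" "letter_act (x, b)"] letter_act_cancel[of x "\<not> b"]
    by simp
qed

text \<open>Bounded displacement keeps the number of strands below each bound finite when a
  configuration is moved.\<close>

lemma abs_letter_act_diff_le: "\<bar>letter_act l x - x\<bar> \<le> 1"
  by (cases l rule: letter_act.cases) (auto simp: exchange_def stretch_def shrink_def field_simps)

lemma word_act_word_inv [simp]: "word_act (word_inv w) \<circ> word_act w = id"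
proof (induction w)
  case (Cons l w)
  obtain x b where l: "l = (x, b)" by fastforce
  have "word_act (word_inv (l # w)) \<circ> word_act (l # w)
      = word_act (word_inv w) \<circ> (letter_act (x, \<not> b) \<circ> letter_act (x, \<not> \<not> b)) \<circ> word_act w"
    by (simp add: word_inv_def l comp_assoc)
  also have "\<dots> = id"
    by (simp only: letter_act_cancel comp_id Cons.IH)
  finally show ?case .
qed (simp add: word_inv_def)

section \<open>Invariance of the action under the relations\<close>

abbreviation "tilde_letters \<equiv> sigma_letters \<union> a_letters"
abbreviation "tilde_rels \<equiv> artin_rels \<union> thompson_rels \<union> mixed_rels"

text \<open>Where the relations mention \<open>j - 1\<close>, the variable is renamed so that
  \<open>j\<close> and \<open>Suc j\<close> replace subtraction on naturals.\<close>

lemma tilde_rels_cases: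
  assumes "(u, v) \<in> tilde_rels"
  obtains (far_sigma) i j where "1 \<le> i" "i + 2 \<le> j" "u = [sg i, sg j]" "v = [sg j, sg i]"
  | (braid) i where "1 \<le> i" "u = [sg i, sg (Suc i), sg i]" "v = [sg (Suc i), sg i, sg (Suc i)]"
  | (far_a) i j where "1 \<le> i" "i < j" "u = [al i, al j]" "v = [al (Suc j), al i]"
  | (sigma_a) i j where "1 \<le> i" "i + 2 \<le> j" "u = [sg i, al j]" "v = [al j, sg i]"
  | (a_sigma) i j where "1 \<le> i" "i < j" "u = [al i, sg j]" "v = [sg (Suc j), al i]"
  | (split_left) i where "1 \<le> i" "u = [sg (Suc i), sg i, al (Suc i)]" "v = [al i, sg i]"
  | (split_right) i where "1 \<le> i" "u = [sg i, sg (Suc i), al i]" "v = [al (Suc i), sg i]"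
proof -
  have pred: "\<exists>k. j - 1 = k \<and> j = Suc k \<and> i < k" if "i + 2 \<le> j" for i j :: nat
    using that by (cases j) auto
  from assms show thesis
    unfolding artin_rels_def thompson_rels_def mixed_rels_def Un_iff mem_Collect_eq prod.inject
      Suc_eq_plus1[symmetric]
  proof (elim disjE exE conjE)
    fix i j assume "1 \<le> i" "i + 2 \<le> j" "u = [al i, al (j - 1)]" "v = [al j, al i]"
    then show thesis using pred[of i j] far_a[of i "j - 1"] by auto
  next
    fix i j assume "1 \<le> i" "i + 2 \<le> j" "u = [al i, sg (j - 1)]" "v = [sg j, al i]"
    then show thesis using pred[of i j] a_sigma[of i "j - 1"] by auto
  qed (erule (3) far_sigma sigma_a | erule (2) braid split_left split_right)+
qed

lemma real_less_imp_add1_le: "i < j \<Longrightarrow> real i + 1 \<le> real j"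
  by linarith

lemma word_act_tilde_rels:
  assumes "(u, v) \<in> tilde_rels"
  shows "word_act u = word_act v"
  using assms
proof (cases rule: tilde_rels_cases)
  case (far_sigma i j)
  then show ?thesis by (auto simp: fun_eq_iff exchange_def)
next
  case (braid i)
  then show ?thesis by (auto simp: fun_eq_iff exchange_def)
next
  case (far_a i j)
  then show ?thesis
    using real_less_imp_add1_le[of i j] by (auto simp: fun_eq_iff stretch_def)
next
  case (sigma_a i j)
  then show ?thesis by (auto simp: fun_eq_iff exchange_def stretch_def)
next
  case (a_sigma i j)
  then show ?thesis
    using real_less_imp_add1_le[of i j] by (auto simp: fun_eq_iff exchange_def stretch_def)
next
  case (split_left i)
  then show ?thesis by (auto simp: fun_eq_iff exchange_def stretch_def)
next
  case (split_right i)
  then show ?thesis by (auto simp: fun_eq_iff exchange_def stretch_def)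
qed

lemma word_act_pres_rel:
  assumes "(u, v) \<in> pres_rel X R" "R \<subseteq> tilde_rels"
  shows "word_act u = word_act v"
  using assms(1)
proof (induction rule: pres_rel.induct)
  case (cancel x b)
  show ?case using letter_act_cancel[of x b] by simp
next
  case (rel u v)
  then show ?case using assms(2) by (intro word_act_tilde_rels) auto
qed auto


section \<open>Faithfulness of the action of Thompson's group\<close>

text \<open>Since \<open>A i A k = A (k + 1) A i\<close> for \<open>i < k\<close>, inverses can be moved to the left and positive
  words can be sorted into weakly decreasing order.\<close>

locale thompson_system = group +
  fixes A :: "nat \<Rightarrow> 'a"
  assumes A_closed [simp]: "1 \<le> i \<Longrightarrow> A i \<in> carrier G"
    and A_commute: "1 \<le> i \<Longrightarrow> i < k \<Longrightarrow> A i \<otimes> A k = A (Suc k) \<otimes> A i"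
begin

fun prodA :: "nat list \<Rightarrow> 'a" where
  "prodA [] = \<one>"
| "prodA (i # p) = A i \<otimes> prodA p"

lemma prodA_closed [simp]: "p \<in> lists {1..} \<Longrightarrow> prodA p \<in> carrier G"
  by (induction p) auto

lemma prodA_append: "p \<in> lists {1..} \<Longrightarrow> q \<in> lists {1..} \<Longrightarrow> prodA (p @ q) = prodA p \<otimes> prodA q"
  by (induction p) (auto simp: m_assoc)

text \<open>Multiplying the relation by inverses on both sides moves an inverse to the left: for
  \<open>i < j\<close> the index \<open>j\<close> is raised by one, for \<open>j < i\<close> the
  index \<open>i\<close> is.\<close>

lemma A_inv_A:
  assumes "1 \<le> i" "1 \<le> j" "i \<noteq> j"
  obtains i' j' where "1 \<le> i'" "1 \<le> j'" "A j \<otimes> inv A i = inv A i' \<otimes> A j'"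
proof (cases "i < j")
  case True
  have "A j \<otimes> inv A i = inv A i \<otimes> (A i \<otimes> A j) \<otimes> inv A i"
    using assms by (simp add: m_assoc[symmetric])
  also have "\<dots> = inv A i \<otimes> (A (Suc j) \<otimes> A i) \<otimes> inv A i"
    using True assms by (simp add: A_commute)
  also have "\<dots> = inv A i \<otimes> A (Suc j)"
    using assms by (simp add: m_assoc)
  finally show ?thesis using that[of i "Suc j"] assms by simp
next
  case False
  have "A j \<otimes> inv A i = inv A (Suc i) \<otimes> (A (Suc i) \<otimes> A j) \<otimes> inv A i"
    using assms by (simp add: m_assoc[symmetric])
  also have "\<dots> = inv A (Suc i) \<otimes> (A j \<otimes> A i) \<otimes> inv A i"
    using False assms by (simp add: A_commute)
  also have "\<dots> = inv A (Suc i) \<otimes> A j"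
    using assms by (simp add: m_assoc)
  finally show ?thesis using that[of "Suc i" j] assms by simp
qed

text \<open>The inverse travels left through \<open>p\<close> one letter at a time, cancelling an
  equal letter or emerging at the front; its index may change on the way, so \<open>i\<close> is
  arbitrary in the induction.\<close>

lemma prodA_inv_A:
  assumes "p \<in> lists {1..}" "1 \<le> i"
  shows "\<exists>q \<in> lists {1..}. \<exists>p' \<in> lists {1..}. prodA p \<otimes> inv A i = inv prodA q \<otimes> prodA p'"
  using assms
proof (induction p arbitrary: i rule: rev_induct)
  case Nil
  then show ?case by (intro bexI[of _ "[i]"] bexI[of _ "[]"]) auto
next
  case (snoc j p)
  then have p: "p \<in> lists {1..}" and j: "1 \<le> j" by auto
  show ?case
  proof (cases "i = j")
    case True
    then have "prodA (p @ [j]) \<otimes> inv A i = inv prodA [] \<otimes> prodA p"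
      using p j by (simp add: prodA_append m_assoc del: in_lists_conv_set)
    then show ?thesis using p by (meson lists.Nil)
  next
    case False
    then obtain i' j' where ij': "1 \<le> i'" "1 \<le> j'" "A j \<otimes> inv A i = inv A i' \<otimes> A j'"
      using A_inv_A snoc.prems j by metis
    obtain q p' where qp': "q \<in> lists {1..}" "p' \<in> lists {1..}"
      and "prodA p \<otimes> inv A i' = inv prodA q \<otimes> prodA p'"
      using snoc.IH[OF p ij'(1)] by blast
    have "prodA (p @ [j]) \<otimes> inv A i = prodA p \<otimes> (A j \<otimes> inv A i)"
      using p j snoc.prems(2) by (simp add: prodA_append m_assoc del: in_lists_conv_set)
    also have "\<dots> = prodA p \<otimes> inv A i' \<otimes> A j'"
      using p j ij' by (simp add: m_assoc del: in_lists_conv_set)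
    also have "\<dots> = inv prodA q \<otimes> prodA (p' @ [j'])"
      using ij' qp' \<open>prodA p \<otimes> inv A i' = _\<close>
      by (simp add: prodA_append m_assoc del: in_lists_conv_set)
    finally show ?thesis using qp' ij' by (intro bexI[of _ q] bexI[of _ "p' @ [j']"]) auto
  qed
qed

text \<open>One step of an insertion sort into weakly decreasing order: \<open>A i\<close> passes a
  larger \<open>A k\<close> at the price of raising \<open>k\<close> by one.\<close>

fun insertA :: "nat \<Rightarrow> nat list \<Rightarrow> nat list" where
  "insertA i [] = [i]"
| "insertA i (k # p) = (if i < k then Suc k # insertA i p else i # k # p)"

text \<open>Just strong enough for \<open>sorted_insertA\<close>: behind a raised head
  \<open>Suc k\<close>, every entry is at most \<open>i < k\<close> or at most one more than an old
  entry, which is itself at most \<open>k\<close>.\<close>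

lemma insertA_bounds: "x \<in> set (insertA i p) \<Longrightarrow> x \<le> i \<or> (\<exists>k\<in>set p. x \<le> Suc k)"
proof (induction p)
  case (Cons k p)
  then show ?case by (cases "i < k") force+
qed simp

lemma sorted_insertA: "sorted_wrt (\<ge>) p \<Longrightarrow> sorted_wrt (\<ge>) (insertA i p)"
  by (induction p) (fastforce dest!: insertA_bounds)+

lemma insertA_lists: "1 \<le> i \<Longrightarrow> p \<in> lists {1..} \<Longrightarrow> insertA i p \<in> lists {1..}"
  by (induction p) auto

lemma prodA_insertA:
  "1 \<le> i \<Longrightarrow> p \<in> lists {1..} \<Longrightarrow> prodA (insertA i p) = A i \<otimes> prodA p"
proof (induction p)
  case (Cons k p)
  then have k: "1 \<le> k" and p: "p \<in> lists {1..}" by auto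
  show ?case
    using Cons.IH[OF Cons.prems(1) p] Cons.prems(1) k p A_commute[of i k]
    by (auto simp: m_assoc[symmetric] simp del: in_lists_conv_set)
qed simp

lemma prodA_sorted:
  "p \<in> lists {1..} \<Longrightarrow> \<exists>q \<in> lists {1..}. sorted_wrt (\<ge>) q \<and> prodA q = prodA p"
proof (induction p)
  case (Cons i p)
  then obtain q where "q \<in> lists {1..}" "sorted_wrt (\<ge>) q" "prodA q = prodA p"
    by auto
  moreover have "1 \<le> i" using Cons.prems by auto
  ultimately show ?case
    by (intro bexI[of _ "insertA i q"])
      (simp_all add: insertA_lists sorted_insertA prodA_insertA del: in_lists_conv_set)
qed (intro bexI[of _ "[]"], auto)

lemma generate_A_fraction:
  assumes "g \<in> generate G (A ` {1..})"
  obtains p q where "p \<in> lists {1..}" "q \<in> lists {1..}" "sorted_wrt (\<ge>) p" "sorted_wrt (\<ge>) q"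
    "g = inv prodA p \<otimes> prodA q"
proof -
  define F where "F = {inv prodA p \<otimes> prodA q | p q. p \<in> lists {1..} \<and> q \<in> lists {1..}}"
  have F_carrier: "F \<subseteq> carrier G" 
    unfolding F_def by (rule subsetI, elim CollectE exE conjE) (simp del: in_lists_conv_set)
  have sub: "A ` {1..} \<subseteq> carrier G" by auto
  \<comment> \<open>\<open>F\<close> is not visibly closed under products, so the induction shows
    that it absorbs subgroup elements from the right; applying this to the unit gives
    \<open>g \<in> F\<close>.\<close>
  have "\<forall>f\<in>F. f \<otimes> g \<in> F"
    using assms
  proof (induction rule: generate.induct)
    case one
    then show ?case using F_carrier by auto
  next
    case (incl h)
    show ?case
    proof
      fix f assume "f \<in> F"
      then obtain p q where pq: "p \<in> lists {1..}" "q \<in> lists {1..}" "f = inv prodA p \<otimes> prodA q"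
        unfolding F_def by blast
      obtain i where i: "1 \<le> i" "h = A i" using incl by auto
      then have "f \<otimes> h = inv prodA p \<otimes> prodA (q @ [i])"
        using pq by (simp add: prodA_append m_assoc del: in_lists_conv_set)
      moreover have "q @ [i] \<in> lists {1..}" using pq i by auto
      ultimately show "f \<otimes> h \<in> F" using pq(1) unfolding F_def by blast
    qed
  next
    case (inv h)
    show ?case
    proof
      fix f assume "f \<in> F"
      then obtain p q where pq: "p \<in> lists {1..}" "q \<in> lists {1..}" "f = inv prodA p \<otimes> prodA q"
        unfolding F_def by blast
      obtain i where i: "1 \<le> i" "h = A i" using inv by auto
      obtain r q' where rq: "r \<in> lists {1..}" "q' \<in> lists {1..}"
        "prodA q \<otimes> inv A i = inv prodA r \<otimes> prodA q'"
        using prodA_inv_A[OF pq(2) i(1)] by blast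
      have "f \<otimes> inv h = inv prodA p \<otimes> (prodA q \<otimes> inv A i)"
        using pq i by (simp add: m_assoc del: in_lists_conv_set)
      also have "\<dots> = inv prodA (r @ p) \<otimes> prodA q'"
        using pq rq by (simp add: prodA_append inv_mult_group m_assoc del: in_lists_conv_set)
      finally have "f \<otimes> inv h = inv prodA (r @ p) \<otimes> prodA q'" .
      moreover have "r @ p \<in> lists {1..}" using pq rq by auto
      ultimately show "f \<otimes> inv h \<in> F" using rq(2) unfolding F_def by blast
    qed
  next
    case (eng g h)
    then have "g \<in> carrier G" "h \<in> carrier G"
      using generate_in_carrier[OF sub] by auto
    then show ?case
      using eng.IH F_carrier by (metis m_assoc subsetD)
  qed
  moreover have "\<one> \<in> F"
    unfolding F_def by (auto intro!: exI[of _ "[]"])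
  moreover have "g \<in> carrier G"
    using generate_in_carrier[OF sub assms] .
  ultimately have "g \<in> F" by (metis l_one)
  then obtain p q where pq: "p \<in> lists {1..}" "q \<in> lists {1..}" "g = inv prodA p \<otimes> prodA q"
    unfolding F_def by blast
  obtain p' q' where "p' \<in> lists {1..}" "sorted_wrt (\<ge>) p'" "prodA p' = prodA p"
    "q' \<in> lists {1..}" "sorted_wrt (\<ge>) q'" "prodA q' = prodA q"
    using prodA_sorted[OF pq(1)] prodA_sorted[OF pq(2)] by blast
  then show ?thesis using that pq(3) by metis
qed

end

section \<open>Recovering a sorted positive word from its action\<close>

lemma stretch_ge: "x \<le> stretch i x"
  by (simp add: stretch_def)

lemma word_act_map_al_ge: "x \<le> word_act (map al p) x"
  by (induction p) (auto intro: order_trans[OF _ stretch_ge])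

lemma word_act_map_al_fix: "\<forall>j\<in>set p. i < j \<Longrightarrow> word_act (map al p) (real i) = real i"
  by (induction p) (auto simp: stretch_def)

text \<open>The letter \<open>i\<close> acts first and takes the point \<open>i\<close> to
  \<open>i + 1\<close>; no further stretch moves a point to the left.\<close>

lemma word_act_map_al_move: "word_act (map al (p @ [i])) (real i) > real i"
  using word_act_map_al_ge[of "real i + 1" p] by (simp add: stretch_def)

text \<open>The last letter of a weakly decreasing word is its smallest, and it is the least natural
  number that the word moves. Equal actions thus have equal last letters, which can be
  removed.\<close>

lemma word_act_sorted_inj:
  assumes "sorted_wrt (\<ge>) p" "sorted_wrt (\<ge>) q" "word_act (map al p) = word_act (map al q)"
  shows "p = q"
  using assms
proof (induction p arbitrary: q rule: rev_induct)
  case Nil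
  show ?case
  proof (cases q rule: rev_cases)
    case (snoc q' j)
    then show ?thesis using word_act_map_al_move[of j q'] Nil.prems(3) 
      by (metis id_apply less_irrefl list.simps(8) word_act_simps(1))
  qed simp
next
  case (snoc i p)
  show ?case
  proof (cases q rule: rev_cases)
    case Nil
    then show ?thesis using word_act_map_al_move[of i p] snoc.prems(3) 
      by (metis id_apply less_irrefl list.simps(8) word_act_simps(1))
  next
    case q: (snoc q' j)
    have "\<not> i < j"
    proof
      assume "i < j"
      then have "word_act (map al q) (real i) = real i"
        using snoc.prems(2) q by (intro word_act_map_al_fix) (auto simp: sorted_wrt_append)
      then show False using word_act_map_al_move[of i p] snoc.prems(3) by (metis less_irrefl)
    qed
    moreover have "\<not> j < i"
    proof
      assume "j < i"
      then have "word_act (map al (p @ [i])) (real j) = real j"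
        using snoc.prems(1) by (intro word_act_map_al_fix) (auto simp: sorted_wrt_append)
      then show False using word_act_map_al_move[of j q'] snoc.prems(3) q by (metis less_irrefl)
    qed
    ultimately have "i = j" by simp
    \<comment> \<open>Evaluating at \<open>shrink i x\<close> undoes the common last letter.\<close>
    have "word_act (map al p) x = word_act (map al q') x" for x
      using fun_cong[OF snoc.prems(3), of "shrink i x"] q \<open>i = j\<close> by simp
    then have "p = q'"
      using snoc.prems q by (intro snoc.IH) (auto simp: sorted_wrt_append)
    then show ?thesis using q \<open>i = j\<close> by simp
  qed
qed

lemma map_al_words: "p \<in> lists {1..} \<Longrightarrow> map al p \<in> words a_letters"
  by (auto simp: a_letters_def)

text \<open>If a fraction of sorted positive words acts trivially, numerator and denominator act
  alike, hence are the same word, and the fraction cancels freely.\<close>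

lemma thompson_F_faithful:
  assumes w: "w \<in> words a_letters" and act: "word_act w = id"
  shows "(w, []) \<in> pres_rel a_letters thompson_rels"
proof -
  let ?c = "\<lambda>w. pres_rel a_letters thompson_rels `` {w}"
  interpret group thompson_F
    unfolding thompson_F_def by (rule group_presented_group)
  have gen: "thompson_F_gen i = ?c [al i]" for i
    by (simp add: thompson_F_gen_def pres_gen_def)
  interpret thompson_system thompson_F thompson_F_gen
  proof
    fix i k :: nat assume i: "1 \<le> i"
    then show "thompson_F_gen i \<in> carrier thompson_F"
      unfolding gen thompson_F_def by (intro class_in_carrier) (auto simp: a_letters_def)
    assume ik: "i < k"
    have letters: "[al i] \<in> words a_letters" "[al k] \<in> words a_letters"
      "[al (Suc k)] \<in> words a_letters"
      using i ik by (auto simp: a_letters_def)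
    have "([al i, al k], [al (Suc k), al i]) \<in> thompson_rels"
      unfolding thompson_rels_def using i ik by (intro CollectI exI[of _ i] exI[of _ "Suc k"]) auto
    then have "([al i, al k], [al (Suc k), al i]) \<in> pres_rel a_letters thompson_rels"
      using letters by (intro pres_rel.rel) auto
    then show "thompson_F_gen i \<otimes>\<^bsub>thompson_F\<^esub> thompson_F_gen k
        = thompson_F_gen (Suc k) \<otimes>\<^bsub>thompson_F\<^esub> thompson_F_gen i"
      using equiv_class_eq[OF equiv_pres_rel]
      unfolding gen thompson_F_def by (simp add: presented_group_mult letters del: in_lists_conv_set Cons_in_lists_iff)
  qed
  note mult = presented_group_mult[of _ a_letters _ thompson_rels, folded thompson_F_def]
  have prodA: "prodA p = ?c (map al p)" if "p \<in> lists {1..}" for p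
    using that
  proof (induction p)
    case Nil
    show ?case by (simp add: one_presented_group[of a_letters thompson_rels, folded thompson_F_def])
  next
    case (Cons i p)
    then have "[al i] \<in> words a_letters" "map al p \<in> words a_letters"
      using map_al_words[of p] by (auto simp: a_letters_def)
    moreover have "prodA p = ?c (map al p)"
      using Cons by simp
    ultimately show ?case
      using mult[of "[al i]" "map al p"] by (simp add: gen[of i])
  qed
  have "thompson_F_gen ` {1..} = pres_gen a_letters thompson_rels ` a_letters"
    by (auto simp: thompson_F_gen_def a_letters_def)
  then have "?c w \<in> generate thompson_F (thompson_F_gen ` {1..})"
    using class_in_carrier[OF w] generate_pres_gen[of a_letters thompson_rels]
    by (simp add: thompson_F_def)
  then obtain p q where p: "p \<in> lists {1..}" "sorted_wrt (\<ge>) p"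
    and q: "q \<in> lists {1..}" "sorted_wrt (\<ge>) q"
    and frac: "?c w = inv\<^bsub>thompson_F\<^esub> prodA p \<otimes>\<^bsub>thompson_F\<^esub> prodA q"
    by (rule generate_A_fraction)
  define v where "v = word_inv (map al p) @ map al q"
  have pw: "map al p \<in> words a_letters" and qw: "map al q \<in> words a_letters"
    using p q map_al_words by blast+
  then have v: "v \<in> words a_letters"
    using word_inv_words[OF pw] by (auto simp: v_def)
  have "?c w = ?c v"
    unfolding frac prodA[OF p(1)] prodA[OF q(1)] v_def
    by (simp only: thompson_F_def inv_pres_rel_class[OF pw]
        presented_group_mult[OF word_inv_words[OF pw] qw])
  then have wv: "(w, v) \<in> pres_rel a_letters thompson_rels"
    using pres_rel_class_eq_iff[OF w v] by simp
  then have "word_act v = id"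
    using word_act_pres_rel act by (metis sup.cobounded1 sup.cobounded2 sup.coboundedI1)
  then have "word_act (map al p) \<circ> word_act (word_inv (map al p)) \<circ> word_act (map al q)
      = word_act (map al p)"
    by (simp add: v_def comp_assoc)
  moreover have "word_act (map al p) \<circ> word_act (word_inv (map al p)) = id"
    using word_act_word_inv[of "word_inv (map al p)"] by simp
  ultimately have "p = q"
    using p q by (intro word_act_sorted_inj) auto
  then have "(v, []) \<in> pres_rel a_letters thompson_rels"
    unfolding v_def using word_inv_cancel[OF qw] by simp
  with wv show ?thesis by (rule pres_rel.trans)
qed

text \<open>All relations of the large group preserve the action, and the action detects equality in
  \<open>thompson_F\<close>.\<close>

lemma thompson_conservative:
  assumes "u \<in> words a_letters" "v \<in> words a_letters" "(u, v) \<in> pres_rel tilde_letters tilde_rels"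
  shows "(u, v) \<in> pres_rel a_letters thompson_rels"
proof (rule pres_rel_if_word_inv_append[OF assms(1,2)], rule thompson_F_faithful)
  show "word_inv v @ u \<in> words a_letters"
    using assms word_inv_words[OF assms(2)] by auto
  show "word_act (word_inv v @ u) = id"
    using word_act_pres_rel[OF assms(3)] by simp
qed


section \<open>Block crossings\<close>

locale braid_system = group +
  fixes s :: "nat \<Rightarrow> 'a"
  assumes s_closed [simp]: "1 \<le> i \<Longrightarrow> s i \<in> carrier G"
    and s_commute: "1 \<le> i \<Longrightarrow> i + 2 \<le> j \<Longrightarrow> s i \<otimes> s j = s j \<otimes> s i"
    and s_braid: "1 \<le> i \<Longrightarrow> s i \<otimes> s (Suc i) \<otimes> s i = s (Suc i) \<otimes> s i \<otimes> s (Suc i)"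
begin

text \<open>\<open>cross c m n\<close> passes the \<open>m\<close> strands at positions \<open>c + 1, \<dots>, c + m\<close> across the
  \<open>n\<close> strands to their right, and \<open>row c n\<close> is the case \<open>m = 1\<close>.\<close>

fun row :: "nat \<Rightarrow> nat \<Rightarrow> 'a" where
  "row c 0 = \<one>"
| "row c (Suc n) = s (Suc c) \<otimes> row (Suc c) n"

fun cross :: "nat \<Rightarrow> nat \<Rightarrow> nat \<Rightarrow> 'a" where
  "cross c 0 n = \<one>"
| "cross c (Suc m) n = cross (Suc c) m n \<otimes> row c n"

lemma row_closed [simp]: "row c n \<in> carrier G"
  by (induction n arbitrary: c) auto

lemma cross_closed [simp]: "cross c m n \<in> carrier G"
  by (induction m arbitrary: c) auto

lemma commute_mult:
  assumes "x \<in> carrier G" "y \<in> carrier G" "z \<in> carrier G" "x \<otimes> y = y \<otimes> x" "x \<otimes> z = z \<otimes> x"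
  shows "x \<otimes> (y \<otimes> z) = y \<otimes> z \<otimes> x"
  using assms by (metis m_assoc)

lemma row_commute:
  assumes "x \<in> carrier G" "\<And>k. c < k \<Longrightarrow> k \<le> c + n \<Longrightarrow> x \<otimes> s k = s k \<otimes> x"
  shows "x \<otimes> row c n = row c n \<otimes> x"
  using assms(2)
proof (induction n arbitrary: c)
  case (Suc n)
  have "x \<otimes> row (Suc c) n = row (Suc c) n \<otimes> x"
    by (rule Suc.IH) (rule Suc.prems; simp)
  then show ?case
    using assms(1) Suc.prems[of "Suc c"] by (simp add: commute_mult)
qed (use assms(1) in simp)

lemma cross_commute:
  assumes "x \<in> carrier G" "\<And>k. c < k \<Longrightarrow> k < c + m + n \<Longrightarrow> x \<otimes> s k = s k \<otimes> x"
  shows "x \<otimes> cross c m n = cross c m n \<otimes> x"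
  using assms(2)
proof (induction m arbitrary: c)
  case (Suc m)
  have "x \<otimes> cross (Suc c) m n = cross (Suc c) m n \<otimes> x"
    by (rule Suc.IH) (rule Suc.prems; simp)
  moreover have "x \<otimes> row c n = row c n \<otimes> x"
    using assms(1) by (rule row_commute) (rule Suc.prems; simp)
  ultimately show ?case
    using assms(1) by (simp add: commute_mult)
qed (use assms(1) in simp)

text \<open>The generators on the two sides have indices below \<open>c + m + n\<close> and above
  \<open>d\<close>, hence at distance at least 2.\<close>

lemma cross_cross_commute:
  assumes "c + m + n \<le> d"
  shows "cross c m n \<otimes> cross d k l = cross d k l \<otimes> cross c m n"
proof (rule cross_commute)
  fix i assume i: "d < i"
  show "cross c m n \<otimes> s i = s i \<otimes> cross c m n"
  proof (rule cross_commute[symmetric])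
    fix j assume "c < j" "j < c + m + n"
    then show "s i \<otimes> s j = s j \<otimes> s i"
      using s_commute[of j i] assms i by simp
  qed (use i in simp)
qed simp

lemma row_add: "row c (m + n) = row c m \<otimes> row (c + m) n"
  by (induction m arbitrary: c) (auto simp: m_assoc)

lemma cross_add_left: "cross c (x + y) z = cross (c + x) y z \<otimes> cross c x z"
  by (induction x arbitrary: c) (auto simp: m_assoc)

lemma cross_add_right: "cross c x (y + z) = cross c x y \<otimes> cross (c + y) x z"
proof (induction x arbitrary: c)
  case (Suc x)
  \<comment> \<open>\<open>cross c 1 y\<close> is \<open>row c y\<close>; the strand crossing the
    \<open>y\<close> block and the \<open>x\<close> strands crossing the \<open>z\<close> block
    occupy disjoint ranges of positions.\<close>
  have "cross c 1 y \<otimes> cross (Suc c + y) x z = cross (Suc c + y) x z \<otimes> cross c 1 y"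
    by (rule cross_cross_commute) simp
  then have "cross (Suc c + y) x z \<otimes> row c y = row c y \<otimes> cross (Suc c + y) x z"
    by (simp add: One_nat_def)
  then have "cross (Suc c + y) x z \<otimes> (row c y \<otimes> row (c + y) z)
      = row c y \<otimes> (cross (Suc c + y) x z \<otimes> row (c + y) z)"
    by (simp add: m_assoc[symmetric])
  then show ?case
    using Suc.IH[of "Suc c"] by (simp add: row_add m_assoc)
qed simp

text \<open>A crossing among the \<open>n\<close> strands slides along the single strand. The braid
  relation enters when \<open>k\<close> is the index of the leading generator; otherwise that
  generator commutes with the shifted crossing.\<close>

lemma row_pass:
  assumes "c < k" "k < c + n"
  shows "row c n \<otimes> s k = s (Suc k) \<otimes> row c n"
  using assms
proof (induction n arbitrary: c)
  case (Suc n)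
  show ?case
  proof (cases "k = Suc c")
    case True
    with Suc.prems obtain n' where n: "n = Suc n'" by (cases n) auto
    have "s k \<otimes> row (Suc k) n' = row (Suc k) n' \<otimes> s k"
      using Suc.prems by (intro row_commute s_commute) auto
    then have "row c (Suc n) \<otimes> s k = s k \<otimes> s (Suc k) \<otimes> s k \<otimes> row (Suc k) n'"
      using True n by (simp add: m_assoc)
    also have "\<dots> = s (Suc k) \<otimes> row c (Suc n)"
      using True n s_braid[of k] by (simp add: m_assoc)
    finally show ?thesis .
  next
    case False
    then have "row (Suc c) n \<otimes> s k = s (Suc k) \<otimes> row (Suc c) n"
      using Suc.prems by (intro Suc.IH) auto
    then have "row c (Suc n) \<otimes> s k = s (Suc c) \<otimes> s (Suc k) \<otimes> row (Suc c) n"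
      using Suc.prems by (simp add: m_assoc)
    also have "s (Suc c) \<otimes> s (Suc k) = s (Suc k) \<otimes> s (Suc c)"
      using False Suc.prems by (intro s_commute) auto
    finally show ?thesis by (simp add: m_assoc)
  qed
qed simp

lemma cross_pass:
  assumes "c < k" "k < c + n"
  shows "cross c m n \<otimes> s k = s (k + m) \<otimes> cross c m n"
  using assms
proof (induction m arbitrary: c k)
  case (Suc m)
  have "cross c (Suc m) n \<otimes> s k = cross (Suc c) m n \<otimes> s (Suc k) \<otimes> row c n"
    using Suc.prems by (simp add: m_assoc row_pass)
  also have "\<dots> = s (k + Suc m) \<otimes> cross c (Suc m) n"
    using Suc.prems Suc.IH[of "Suc c" "Suc k"] by (simp add: m_assoc)
  finally show ?case .
qed simp

lemma cross_row_pass: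
  assumes "c \<le> d" "d + m < c + n"
  shows "cross c x n \<otimes> row d m = row (d + x) m \<otimes> cross c x n"
  using assms
proof (induction m arbitrary: d)
  case (Suc m)
  have "cross c x n \<otimes> row d (Suc m) = s (Suc d + x) \<otimes> (cross c x n \<otimes> row (Suc d) m)"
    using Suc.prems cross_pass[of c "Suc d" n x] by (simp add: m_assoc[symmetric])
  then show ?case
    using Suc.prems Suc.IH[of "Suc d"] by (simp add: m_assoc)
qed simp

text \<open>A block crossing inside the \<open>n\<close> strands may take place on either side of
  the passage of the \<open>x\<close> strands, with its position shifted by
  \<open>x\<close>.\<close>

lemma cross_cross_pass:
  assumes "c \<le> d" "d + y + z \<le> c + n"
  shows "cross c x n \<otimes> cross d y z = cross (d + x) y z \<otimes> cross c x n"
  using assms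
proof (induction y arbitrary: d)
  case (Suc y)
  have "cross c x n \<otimes> cross d (Suc y) z = cross (Suc d + x) y z \<otimes> (cross c x n \<otimes> row d z)"
    using Suc.prems Suc.IH[of "Suc d"] by (simp add: m_assoc[symmetric])
  then show ?case
    using Suc.prems cross_row_pass[of c d z n x] by (simp add: m_assoc)
qed simp

text \<open>The braid relation for cables: the \<open>x\<close> strands cross \<open>y\<close> and
  \<open>z\<close> as one merged block, and the crossing of \<open>y\<close> with \<open>z\<close>
  slides through them.\<close>

lemma cross_yang_baxter:
  "cross c x y \<otimes> (cross (c + y) x z \<otimes> cross c y z)
    = cross (c + x) y z \<otimes> (cross c x z \<otimes> cross (c + z) x y)"
proof -
  have "cross c x y \<otimes> (cross (c + y) x z \<otimes> cross c y z) = cross c x (y + z) \<otimes> cross c y z"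
    by (simp add: cross_add_right m_assoc)
  also have "\<dots> = cross (c + x) y z \<otimes> cross c x (z + y)"
    using cross_cross_pass[of c c y z "y + z" x] by (simp add: add.commute)
  also have "\<dots> = cross (c + x) y z \<otimes> (cross c x z \<otimes> cross (c + z) x y)"
    by (simp only: cross_add_right)
  finally show ?thesis .
qed

end


section \<open>The strand cocycle\<close>

definition below :: "real set \<Rightarrow> nat \<Rightarrow> nat" where
  "below P k = card (P \<inter> {..<real k - 1})"

definition block :: "real set \<Rightarrow> nat \<Rightarrow> nat" where
  "block P k = card (P \<inter> {real k - 1..<real k})"

text \<open>Strands may continue without end to the right, yet the sets counted by
  \<open>below\<close> and \<open>block\<close> are finite, so \<open>card\<close> does not fall
  back to its default 0.\<close>

definition finite_below :: "real set \<Rightarrow> bool" where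
  "finite_below P \<longleftrightarrow> (\<forall>b. finite (P \<inter> {..<b}))"

lemma finite_below_Int: "finite_below P \<Longrightarrow> J \<subseteq> {..<b} \<Longrightarrow> finite (P \<inter> J)"
  unfolding finite_below_def by (meson Int_mono finite_subset order_refl)

lemma finite_below_vimage:
  assumes "finite_below P"
  shows "finite_below (letter_act l -` P)"
  unfolding finite_below_def
proof
  fix b
  have "letter_act l -` P \<inter> {..<b} \<subseteq> letter_act l -` (P \<inter> {..<b + 1})"
  proof
    fix x assume "x \<in> letter_act l -` P \<inter> {..<b}"
    then show "x \<in> letter_act l -` (P \<inter> {..<b + 1})"
      using abs_letter_act_diff_le[of l x] by auto
  qed
  moreover have "finite (letter_act l -` (P \<inter> {..<b + 1}))"
    using assms bij_letter_act[of l]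
    by (intro finite_vimageI) (auto simp: finite_below_def bij_is_inj)
  ultimately show "finite (letter_act l -` P \<inter> {..<b})"
    by (rule finite_subset)
qed

text \<open>Turns a count for a moved configuration into a count in \<open>P\<close> over a moved
  interval.\<close>

lemma card_vimage_Int:
  assumes "\<And>x. f (g x) = x" "\<And>x. g (f x) = x"
  shows "card (f -` P \<inter> J) = card (P \<inter> g -` J)"
proof (rule bij_betw_same_card)
  show "bij_betw f (f -` P \<inter> J) (P \<inter> g -` J)"
    by (rule bij_betw_byWitness[where f' = g]) (auto simp: assms)
qed

lemma card_Int_Un:
  assumes "finite_below P" "J \<subseteq> {..<b}" "K \<subseteq> {..<b}" "J \<inter> K = {}"
  shows "card (P \<inter> (J \<union> K)) = card (P \<inter> J) + card (P \<inter> K)"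
  unfolding Int_Un_distrib
  using assms by (intro card_Un_disjoint) (auto intro: finite_below_Int)

lemma below_Suc:
  assumes "finite_below P"
  shows "below P (Suc k) = below P k + block P k"
proof -
  have "{..<real (Suc k) - 1} = {..<real k - 1} \<union> {real k - 1..<real k}" by auto
  moreover have "card (P \<inter> ({..<real k - 1} \<union> {real k - 1..<real k}))
      = card (P \<inter> {..<real k - 1}) + card (P \<inter> {real k - 1..<real k})"
    by (rule card_Int_Un[OF assms, of _ "real k"]) auto
  ultimately show ?thesis
    by (simp only: below_def block_def)
qed

lemma below_mono: "finite_below P \<Longrightarrow> i \<le> j \<Longrightarrow> below P i \<le> below P j"
  unfolding below_def by (rule card_mono[OF finite_below_Int[OF _ order_refl]]) auto

text \<open>Exchanging two adjacent intervals affects only the count at the cut point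
  \<open>i\<close> between them.\<close>

lemma below_exchange:
  assumes "finite_below P"
  shows "below (exchange i -` P) k = (if k = Suc i then below P i + block P (Suc i) else below P k)"
proof -
  have "below (exchange i -` P) k = card (P \<inter> exchange i -` {..<real k - 1})"
    unfolding below_def by (rule card_vimage_Int) simp_all
  also have "exchange i -` {..<real k - 1} = (if k = Suc i
      then {..<real i - 1} \<union> {real (Suc i) - 1..<real (Suc i)} else {..<real k - 1})"
    using real_less_imp_add1_le[of k i] real_less_imp_add1_le[of "Suc i" k]
    by (cases k "Suc i" rule: linorder_cases) (auto simp: exchange_def split: if_splits)
  also have "card (P \<inter> \<dots>) = (if k = Suc i then below P i + block P (Suc i) else below P k)"
    by (simp only: below_def block_def split: if_split)
      (intro conjI impI card_Int_Un[OF assms, of _ "real (Suc i)"] HOL.refl; auto)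
  finally show ?thesis .
qed

lemma block_exchange:
  "block (exchange i -` P) k
    = (if k = i then block P (Suc i) else if k = Suc i then block P i else block P k)"
proof -
  have "block (exchange i -` P) k = card (P \<inter> exchange i -` {real k - 1..<real k})"
    unfolding block_def by (rule card_vimage_Int) simp_all
  also have "exchange i -` {real k - 1..<real k} = (if k = i then {real (Suc i) - 1..<real (Suc i)}
      else if k = Suc i then {real i - 1..<real i} else {real k - 1..<real k})"
    using real_less_imp_add1_le[of k i] real_less_imp_add1_le[of "Suc i" k]
    by (cases k "Suc i" rule: linorder_cases; cases "k = i")
      (auto simp: exchange_def split: if_splits)
  finally show ?thesis by (simp add: block_def)
qed

text \<open>\<open>stretch i\<close> fixes the cut point \<open>k - 1\<close> if
  \<open>k \<le> i\<close> and moves it to \<open>k\<close> otherwise.\<close>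

lemma below_stretch:
  "below (stretch i -` P) k = (if k \<le> i then below P k else below P (Suc k))"
proof -
  have "below (stretch i -` P) k = card (P \<inter> shrink i -` {..<real k - 1})"
    unfolding below_def by (rule card_vimage_Int) simp_all
  also have "shrink i -` {..<real k - 1}
      = (if k \<le> i then {..<real k - 1} else {..<real (Suc k) - 1})"
    using real_less_imp_add1_le[of i k] by (auto simp: shrink_def not_le split: if_splits)
  finally show ?thesis by (simp add: below_def)
qed

text \<open>Block sizes are differences of consecutive values of \<open>below\<close>. The two
  blocks merge because \<open>stretch i\<close> maps \<open>[i - 1, i)\<close> onto
  \<open>[i - 1, i + 1)\<close>.\<close>

lemma block_stretch:
  assumes "finite_below P"
  shows "block (stretch i -` P) k = (if k < i then block P k
    else if k = i then block P i + block P (Suc i) else block P (Suc k))"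
  using below_Suc[OF assms, of k] below_Suc[OF assms, of "Suc k"]
    below_Suc[OF finite_below_vimage[OF assms, of "al i"], of k]
  by (cases k i rule: linorder_cases) (auto simp: below_stretch)

section \<open>The cocycle and its invariance\<close>

context braid_system
begin

text \<open>A negative letter must undo the crossing that starts from the exchanged configuration,
  so the two block sizes appear interchanged.\<close>

fun letter_cross :: "letter \<times> bool \<Rightarrow> real set \<Rightarrow> 'a" where
  "letter_cross (Sig i, b) P = (if b then cross (below P i) (block P i) (block P (Suc i))
    else inv cross (below P i) (block P (Suc i)) (block P i))"
| "letter_cross (Aa i, b) P = \<one>"

text \<open>Read \<open>P\<close> as the set of strands among the points of the line: \<open>word_cross w P\<close> is the braid
  that these strands undergo under \<open>w\<close>.\<close>

fun word_cross :: "letter word \<Rightarrow> real set \<Rightarrow> 'a" where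
  "word_cross [] P = \<one>"
| "word_cross (l # w) P = letter_cross l P \<otimes> word_cross w (letter_act l -` P)"

lemma letter_cross_closed [simp]: "letter_cross l P \<in> carrier G"
  by (cases l rule: letter_act.cases) auto

lemma word_cross_closed [simp]: "word_cross w P \<in> carrier G"
  by (induction w arbitrary: P) auto

text \<open>The cocycle identity. Preimages occur because words are read from the left while the
  leftmost letter acts last.\<close>

lemma word_cross_append:
  "word_cross (u @ v) P = word_cross u P \<otimes> word_cross v (word_act u -` P)"
  by (induction u arbitrary: P) (auto simp: m_assoc vimage_comp[symmetric])

lemma letter_cross_cancel:
  assumes "finite_below P"
  shows "letter_cross (x, b) P \<otimes> letter_cross (x, \<not> b) (letter_act (x, b) -` P) = \<one>"
  using assms by (cases x) (auto simp: below_exchange block_exchange)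

text \<open>The braid relation becomes \<open>cross_yang_baxter\<close>, distant \<open>Sig\<close>
  letters give commuting crossings, and the splitting relations say that a block may cross in two
  pieces. In the other three relations both sides have the same crossings once the counts are
  computed.\<close>

lemma word_cross_tilde_rels:
  assumes P: "finite_below P" and uv: "(u, v) \<in> tilde_rels"
  shows "word_cross u P = word_cross v P"
proof -
  have P': "finite_below (exchange i -` P)" "finite_below (stretch i -` P)"
    if "finite_below P" for i P
    using finite_below_vimage[OF that, of "sg i"] finite_below_vimage[OF that, of "al i"] by simp_all
  note [simp] = P P' below_exchange block_exchange below_stretch block_stretch below_Suc
  from uv show ?thesis
  proof (cases rule: tilde_rels_cases)
    case (far_sigma i j)
    \<comment> \<open>All strands in the blocks \<open>i\<close> and \<open>Suc i\<close> lie to the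
      left of block \<open>j\<close>.\<close>
    then have "below P i + block P i + block P (Suc i) \<le> below P j"
      using below_mono[OF P, of "Suc (Suc i)" j] by simp
    from cross_cross_commute[OF this] far_sigma show ?thesis
      by simp
  next
    case (braid i)
    then show ?thesis
      using cross_yang_baxter by simp
  next
    case (split_left i)
    then show ?thesis by (simp add: cross_add_left)
  next
    case (split_right i)
    then show ?thesis by (simp add: cross_add_right)
  qed simp_all
qed

lemma word_cross_pres_rel:
  assumes "(u, v) \<in> pres_rel X R" "R \<subseteq> tilde_rels" "finite_below P"
  shows "word_cross u P = word_cross v P"
  using assms(1,3)
proof (induction arbitrary: P rule: pres_rel.induct)
  case (ctxt u v p q)
  \<comment> \<open>The prefix \<open>p\<close> moves the configuration, which is why
    \<open>P\<close> is arbitrary; the suffix \<open>q\<close> then meets the same configuration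
    after \<open>u\<close> and after \<open>v\<close>, since these act equally.\<close>
  have "finite_below (word_act p -` P)"
    using ctxt.prems
    by (induction p arbitrary: P) (auto simp: vimage_comp[symmetric] intro: finite_below_vimage)
  then show ?case
    using ctxt.IH word_act_pres_rel[OF ctxt.hyps(1) assms(2)]
    by (simp add: word_cross_append)
next
  case (cancel x b)
  then show ?case using letter_cross_cancel[of P x b] by simp
next
  case (rel u v)
  then show ?case using assms(2) by (intro word_cross_tilde_rels) auto
qed auto

end

section \<open>The configuration with a strand at each natural number\<close>

lemma finite_below_range_real: "finite_below (range real)"
  unfolding finite_below_def
proof
  fix b :: real
  have "range real \<inter> {..<b} \<subseteq> real ` {..nat \<lceil>b\<rceil>}"
    by (auto intro!: imageI) linarith
  then show "finite (range real \<inter> {..<b})" by (rule finite_subset) simp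
qed

lemma below_range_real:
  assumes "1 \<le> k"
  shows "below (range real) k = k - 1"
proof -
  have "range real \<inter> {..<real k - 1} = real ` {..<k - 1}"
    using assms by (auto simp: of_nat_diff)
  then show ?thesis by (simp add: below_def card_image)
qed

lemma block_range_real:
  assumes "1 \<le> k"
  shows "block (range real) k = 1"
  using below_Suc[OF finite_below_range_real, of k] assms by (simp add: below_range_real)

text \<open>By this invariance every letter of a braid word is evaluated on blocks of a single
  strand.\<close>

lemma exchange_vimage_range_real:
  assumes "1 \<le> i"
  shows "exchange i -` range real = range real"
proof -
  have sub: "exchange i ` range real \<subseteq> range real"
  proof clarify
    fix n
    have "exchange i (real n) = real (if Suc n = i then Suc n else if n = i then n - 1 else n)"
      using assms by (auto simp: exchange_def of_nat_diff)
    then show "exchange i (real n) \<in> range real" by simp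
  qed
  show ?thesis
  proof
    show "exchange i -` range real \<subseteq> range real"
    proof
      fix x assume "x \<in> exchange i -` range real"
      then have "exchange i (exchange i x) \<in> range real" using sub by blast
      then show "x \<in> range real" by simp
    qed
  qed (use sub in blast)
qed

text \<open>At \<open>range real\<close> the cocycle with values in \<open>B_infinity\<close> sends
  a braid word to its own class, and the relations of the large group do not change its
  value.\<close>

lemma artin_conservative:
  assumes u: "u \<in> words sigma_letters" and v: "v \<in> words sigma_letters"
    and uv: "(u, v) \<in> pres_rel tilde_letters tilde_rels"
  shows "(u, v) \<in> pres_rel sigma_letters artin_rels"
proof -
  let ?c = "\<lambda>w. pres_rel sigma_letters artin_rels `` {w}"
  interpret group B_infinity
    unfolding B_infinity_def by (rule group_presented_group)
  note mult = presented_group_mult[of _ sigma_letters _ artin_rels, folded B_infinity_def]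
  have gen: "B_infinity_gen i = ?c [sg i]" for i
    by (simp add: B_infinity_gen_def pres_gen_def)
  have letter: "[(Sig i, b)] \<in> words sigma_letters" if "1 \<le> i" for i b
    using that by (auto simp: sigma_letters_def)
  interpret braid_system B_infinity B_infinity_gen
  proof
    fix i :: nat assume i: "1 \<le> i"
    then show "B_infinity_gen i \<in> carrier B_infinity"
      unfolding gen B_infinity_def by (intro class_in_carrier letter)
    have w: "[sg k, sg l] \<in> words sigma_letters" "[sg k, sg l, sg m] \<in> words sigma_letters"
      if "1 \<le> k" "1 \<le> l" "1 \<le> m" for k l m
      using that by (auto simp: sigma_letters_def)
    show "B_infinity_gen i \<otimes>\<^bsub>B_infinity\<^esub> B_infinity_gen j
        = B_infinity_gen j \<otimes>\<^bsub>B_infinity\<^esub> B_infinity_gen i" if "i + 2 \<le> j" for j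
    proof -
      have "([sg i, sg j], [sg j, sg i]) \<in> artin_rels"
        unfolding artin_rels_def using i that by auto
      then have "([sg i, sg j], [sg j, sg i]) \<in> pres_rel sigma_letters artin_rels"
        using i that by (intro pres_rel.rel w) auto
      then show ?thesis
        using equiv_class_eq[OF equiv_pres_rel] i that
        by (simp add: gen[of i] gen[of j] mult letter del: in_lists_conv_set Cons_in_lists_iff)
    qed
    have "([sg i, sg (Suc i), sg i], [sg (Suc i), sg i, sg (Suc i)]) \<in> artin_rels"
      unfolding artin_rels_def using i by auto
    then have "([sg i, sg (Suc i), sg i], [sg (Suc i), sg i, sg (Suc i)])
        \<in> pres_rel sigma_letters artin_rels"
      using i by (intro pres_rel.rel w) auto
    then show "B_infinity_gen i \<otimes>\<^bsub>B_infinity\<^esub> B_infinity_gen (Suc i) \<otimes>\<^bsub>B_infinity\<^esub> B_infinity_gen i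
        = B_infinity_gen (Suc i) \<otimes>\<^bsub>B_infinity\<^esub> B_infinity_gen i \<otimes>\<^bsub>B_infinity\<^esub> B_infinity_gen (Suc i)"
      using equiv_class_eq[OF equiv_pres_rel] i
      by (simp add: gen[of i] gen[of "Suc i"] mult letter w del: in_lists_conv_set Cons_in_lists_iff)
  qed
  have "word_cross w (range real) = ?c w" if "w \<in> words sigma_letters" for w
    using that
  proof (induction w rule: list.induct)
    case Nil
    show ?case
      by (simp add: one_presented_group[of sigma_letters artin_rels, folded B_infinity_def])
  next
    case (Cons l w)
    then obtain i b where l: "l = (Sig i, b)" and i: "1 \<le> i"
      by (cases l rule: letter_act.cases) (auto simp: sigma_letters_def)
    have w: "w \<in> words sigma_letters" using Cons.prems by simp
    \<comment> \<open>The single strands at positions \<open>i\<close> and \<open>i + 1\<close>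
      cross by one generator.\<close>
    have "cross (i - 1) 1 1 = B_infinity_gen i"
      using i by (simp add: One_nat_def)
    then have "letter_cross l (range real)
        = (if b then B_infinity_gen i else inv\<^bsub>B_infinity\<^esub> B_infinity_gen i)"
      using i by (simp add: l below_range_real block_range_real)
    also have "\<dots> = ?c [l]"
      using inv_pres_rel_class[OF letter[OF i, of True], of artin_rels, folded B_infinity_def]
      by (simp add: l gen[of i] word_inv_def)
    finally show ?case
      using Cons.IH[OF w] mult[OF letter[OF i, of b] w] i
      by (simp add: l exchange_vimage_range_real)
  qed
  moreover have "word_cross u (range real) = word_cross v (range real)"
    by (rule word_cross_pres_rel[OF uv _ finite_below_range_real]) simp
  ultimately show ?thesis
    using u v pres_rel_class_eq_iff[OF u v, of artin_rels] by simp
qed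


section \<open>Intersection of the two subgroups\<close>

text \<open>Each \<open>exchange\<close> moves a unit interval with integer endpoints by an integer
  translation, and these compose; \<open>m\<close> does not depend on the offset
  \<open>t\<close>.\<close>

lemma sigma_word_act:
  assumes "w \<in> words sigma_letters"
  shows "\<exists>m::int. \<forall>t. 0 \<le> t \<longrightarrow> t < 1 \<longrightarrow> word_act w (of_int n + t) = of_int m + t"
  using assms
proof (induction w)
  case (Cons l w)
  then obtain m where m: "word_act w (of_int n + t) = of_int m + t" if "0 \<le> t" "t < 1" for t
    by auto
  obtain i b where l: "l = (Sig i, b)"
    using Cons.hyps by (cases l rule: letter_act.cases) (auto simp: sigma_letters_def)
  have "exchange i (of_int m + t)
      = of_int (if m = int i - 1 then m + 1 else if m = int i then m - 1 else m) + t"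
    if "0 \<le> t" "t < 1" for t
    using that unfolding exchange_def by (cases "m < int i - 1"; cases "m > int i") (auto; linarith)+
  then show ?case using m by (auto simp: l)
qed auto

lemma strict_mono_word_act:
  assumes "w \<in> words a_letters"
  shows "strict_mono (word_act w)"
  using assms
proof (induction w)
  case (Cons l w)
  then obtain i b where "l = (Aa i, b)" by (cases l rule: letter_act.cases) (auto simp: a_letters_def)
  then have "strict_mono (letter_act l)"
    by (auto simp: strict_mono_def stretch_def shrink_def field_simps)
  with Cons show ?case by (auto simp: strict_mono_def)
qed (simp add: strict_mono_def)

text \<open>Indices start at 1, so all the stretching happens to the right of 0; this anchors the
  induction in \<open>word_act_eq_id\<close>.\<close>

lemma word_act_a_letters_nonpos:
  assumes "w \<in> words a_letters" "x \<le> 0"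
  shows "word_act w x = x"
  using assms
proof (induction w)
  case (Cons l w)
  then obtain i b where "l = (Aa i, b)" "1 \<le> i" by (cases l rule: letter_act.cases) (auto simp: a_letters_def)
  with Cons show ?case by (auto simp: stretch_def shrink_def)
qed simp

text \<open>An increasing bijection that preserves the integers in both directions and fixes 0 fixes
  all natural numbers; being a translation on each unit interval, it is then the identity.\<close>

lemma word_act_eq_id:
  assumes u: "u \<in> words sigma_letters" and v: "v \<in> words a_letters"
    and eq: "word_act u = word_act v"
  shows "word_act v = id"
proof -
  \<comment> \<open>\<open>?g\<close> inverts \<open>?f\<close> but comes from a word in
    \<open>Sig\<close> letters, so integers have integer preimages under \<open>?f\<close>.\<close>
  let ?f = "word_act v" and ?g = "word_act (word_inv u)"
  have mono: "strict_mono ?f" by (rule strict_mono_word_act[OF v])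
  have inv: "?f (?g x) = x" for x
    using fun_cong[OF word_act_word_inv[of "word_inv u"], of x] eq by simp
  have int: "\<exists>m::int. word_act w (of_int n) = of_int m" if "w \<in> words sigma_letters" for w n
    using sigma_word_act[OF that, of n] by (metis add.right_neutral order_refl zero_less_one)
  have nat: "?f (real n) = real n" for n
  proof (induction n)
    case 0
    then show ?case using word_act_a_letters_nonpos[OF v] by simp
  next
    case (Suc n)
    obtain m where m: "?f (real (Suc n)) = of_int m"
      using int[OF u, of "int (Suc n)"] eq by auto
    \<comment> \<open>The preimage \<open>k\<close> of \<open>n + 1\<close> is an integer beyond
      \<open>n\<close>, so monotonicity bounds the image of \<open>n + 1\<close> by
      \<open>n + 1\<close>.\<close>
    obtain k where k: "?g (real (Suc n)) = of_int k"
      using int[OF word_inv_words[OF u], of "int (Suc n)"] by auto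
    have fk: "?f (of_int k) = real (Suc n)" using inv[of "real (Suc n)"] k by simp
    have "real n < of_int k"
      using strict_mono_less[OF mono, of "real n" "of_int k"] fk Suc by simp
    then have "int n < k" by linarith
    then have "real (Suc n) \<le> of_int k" by linarith
    then have "of_int m \<le> real (Suc n)"
      using strict_mono_less_eq[OF mono, of "real (Suc n)" "of_int k"] fk m by simp
    moreover have "real n < of_int m"
      using strict_mono_less[OF mono, of "real n" "real (Suc n)"] m Suc by simp
    ultimately have "m = int (Suc n)" by linarith
    then show ?case using m by simp
  qed
  have floor: "?f (of_int n) = of_int n" for n :: int
    using nat[of "nat n"] word_act_a_letters_nonpos[OF v, of "of_int n"]
    by (cases "0 \<le> n") auto
  have "?f x = x" for x
  proof -
    \<comment> \<open>On the unit interval containing \<open>x\<close> the map is a translation, and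
      its fixed left endpoint makes it trivial.\<close>
    obtain m where m: "?f (of_int \<lfloor>x\<rfloor> + t) = of_int m + t" if "0 \<le> t" "t < 1" for t
      using sigma_word_act[OF u, of "\<lfloor>x\<rfloor>"] eq by auto
    have "of_int m = (of_int \<lfloor>x\<rfloor> :: real)"
      using m[of 0] floor[of "\<lfloor>x\<rfloor>"] by simp
    then show ?thesis
      using m[of "frac x"] frac_ge_0[of x] frac_lt_1[of x] by (simp add: frac_def)
  qed
  then show ?thesis by (simp add: fun_eq_iff)
qed

section \<open>The two subgroups inside \<open>B_tilde\<close>\<close>

theorem proposition2p23:
  defines "S \<equiv> generate B_tilde (B_tilde_sigma ` {1..})"
    and "A \<equiv> generate B_tilde (B_tilde_a ` {1..})"
  shows "(\<exists>h \<in> iso B_infinity (B_tilde\<lparr>carrier := S\<rparr>).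
            \<forall>i\<ge>1. h (B_infinity_gen i) = B_tilde_sigma i)
       \<and> (\<exists>h \<in> iso thompson_F (B_tilde\<lparr>carrier := A\<rparr>).
            \<forall>i\<ge>1. h (thompson_F_gen i) = B_tilde_a i)
       \<and> generate B_tilde (S \<union> A) = carrier B_tilde
       \<and> S \<inter> A = {\<one>\<^bsub>B_tilde\<^esub>}"
proof (intro conjI)
  let ?gen = "pres_gen tilde_letters tilde_rels"
    and ?c = "\<lambda>w. pres_rel tilde_letters tilde_rels `` {w}"
  interpret B: group B_tilde unfolding B_tilde_def by (rule group_presented_group)
  have "B_tilde_sigma ` {1..} = ?gen ` sigma_letters" "B_tilde_a ` {1..} = ?gen ` a_letters"
    by (auto simp: B_tilde_sigma_def B_tilde_a_def sigma_letters_def a_letters_def)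
  then have S: "S = generate B_tilde (?gen ` sigma_letters)"
    and A: "A = generate B_tilde (?gen ` a_letters)"
    by (simp_all add: S_def A_def)
  have S_words: "S = ?c ` words sigma_letters" and A_words: "A = ?c ` words a_letters"
    unfolding S A B_tilde_def by (intro generate_pres_gen_subset; simp)+
  have "\<exists>h \<in> iso B_infinity (B_tilde\<lparr>carrier := S\<rparr>).
      \<forall>x\<in>sigma_letters. h (pres_gen sigma_letters artin_rels x) = ?gen x"
    unfolding S B_infinity_def B_tilde_def
    by (intro presented_subgroup_iso artin_conservative) auto
  then show "\<exists>h \<in> iso B_infinity (B_tilde\<lparr>carrier := S\<rparr>).
      \<forall>i\<ge>1. h (B_infinity_gen i) = B_tilde_sigma i"
    unfolding B_infinity_gen_def B_tilde_sigma_def sigma_letters_def by blast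
  have "\<exists>h \<in> iso thompson_F (B_tilde\<lparr>carrier := A\<rparr>).
      \<forall>x\<in>a_letters. h (pres_gen a_letters thompson_rels x) = ?gen x"
    unfolding A thompson_F_def B_tilde_def
    by (intro presented_subgroup_iso thompson_conservative) auto
  then show "\<exists>h \<in> iso thompson_F (B_tilde\<lparr>carrier := A\<rparr>).
      \<forall>i\<ge>1. h (thompson_F_gen i) = B_tilde_a i"
    unfolding thompson_F_gen_def B_tilde_a_def a_letters_def by blast
  have carrier: "generate B_tilde (?gen ` tilde_letters) = carrier B_tilde"
    unfolding B_tilde_def by (rule generate_pres_gen)
  have gens: "?gen ` tilde_letters \<subseteq> carrier B_tilde"
    unfolding carrier[symmetric] by (rule subsetI) (rule generate.incl)
  show "generate B_tilde (S \<union> A) = carrier B_tilde"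
  proof
    have "S \<subseteq> carrier B_tilde" "A \<subseteq> carrier B_tilde"
      unfolding S A using gens by (intro B.generate_incl; blast)+
    then show "generate B_tilde (S \<union> A) \<subseteq> carrier B_tilde"
      by (intro B.generate_incl) simp
    have "?gen ` tilde_letters \<subseteq> S \<union> A"
      unfolding S A by (auto intro: generate.incl)
    then show "carrier B_tilde \<subseteq> generate B_tilde (S \<union> A)"
      unfolding carrier[symmetric] by (rule B.mono_generate)
  qed
  show "S \<inter> A = {\<one>\<^bsub>B_tilde\<^esub>}"
  proof
    show "S \<inter> A \<subseteq> {\<one>\<^bsub>B_tilde\<^esub>}"
    proof
      fix g assume "g \<in> S \<inter> A"
      then obtain u v where u: "u \<in> words sigma_letters" "g = ?c u"
        and v: "v \<in> words a_letters" "g = ?c v"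
        unfolding S_words A_words by blast
      have "u \<in> words tilde_letters" "v \<in> words tilde_letters"
        using u(1) v(1) by auto
      then have "(u, v) \<in> pres_rel tilde_letters tilde_rels"
        using pres_rel_class_eq_iff u(2) v(2) by blast
      \<comment> \<open>A braid word and an \<open>Aa\<close> word for the same element act alike,
        hence trivially; faithfulness makes the \<open>Aa\<close> word trivial already in
        \<open>thompson_F\<close>.\<close>
      then have "word_act u = word_act v"
        by (rule word_act_pres_rel) simp
      then have "(v, []) \<in> pres_rel a_letters thompson_rels"
        by (intro thompson_F_faithful word_act_eq_id[OF u(1)] v(1))
      then have "(v, []) \<in> pres_rel tilde_letters tilde_rels"
        using pres_rel_mono[of a_letters tilde_letters thompson_rels tilde_rels] by blast
      then show "g \<in> {\<one>\<^bsub>B_tilde\<^esub>}"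
        using equiv_class_eq[OF equiv_pres_rel] v(2)
        by (simp add: B_tilde_def one_presented_group)
    qed
    show "{\<one>\<^bsub>B_tilde\<^esub>} \<subseteq> S \<inter> A"
      by (auto simp: S A intro: generate.one)
  qed
qed

end
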